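(* Let $m\ge 0$ be an integer and let $K,L,K',L'$ be edge-path connected simplicial complexes. Let $\beta:K'\to K$ be a simplicial map having a right strong homotopy inverse and let $\alpha:L\to L'$ be a simplicial map having a left strong homotopy inverse. Let $\varphi,\psi:K\to L$ and $\varphi',\psi':K'\to L'$ be simplicial maps such that $\alpha\circ\varphi\circ\beta\sim\varphi'$ and $\alpha\circ\psi\circ\beta\sim\psi'$. Then $\mathrm{SD}_m(\varphi,\psi)=\mathrm{SD}_m(\varphi',\psi')$.
   Context: Simplicial complexes are abstract simplicial complexes. Simplicial maps $f,g:A\to B$ are contiguous, $f\sim_c g$, if for every simplex $\{v_0,\dots,v_k\}$ of $A$ the set $\{f(v_0),\dots,f(v_k),g(v_0),\dots,g(v_k)\}$ is a simplex of $B$. They are in the same contiguity class, $f\sim g$, if there is a finite sequence of simplicial maps $f=f_0\sim_c f_1\sim_c\dots\sim_c f_n=g$ from $A$ to $B$. A right strong homotopy inverse of $\beta:K'\to K$ is a simplicial map $b:K\to K'$ with $\beta\circ b\sim \mathrm{id}_K$. A left strong homotopy inverse of $\alpha:L\to L'$ is a simplicial map $a:L'\to L$ with $a\circ\alpha\sim\mathrm{id}_L$. For an integer $m\ge 0$ and simplicial maps $\varphi,\psi:K\to L$, the $m$-contiguity distance $\mathrm{SD}_m(\varphi,\psi)$ is the least integer $k\ge 0$ such that $K$ is covered by subcomplexes $K_0,\dots,K_k$ with the property that for each $j$ and every simplicial map $\eta:P\to K_j$ from an $m$-dimensional simplicial complex $P$, the maps $\varphi\circ\eta$ and $\psi\circ\eta$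 are in the same contiguity class (as maps $P\to L$); it is $\infty$ if no such cover exists. *)

theory Defs
  imports Main "HOL-Library.Extended_Nat"
begin

text \<open>A complex is its set of simplices, the vertex set of \<open>K\<close> being \<open>\<Union>K\<close>.  A simplicial map
  is a function on the vertex type whose values outside \<open>\<Union>K\<close> are irrelevant: two simplicial maps
  that agree on \<open>\<Union>K\<close> are contiguous.\<close>

definition simplicial_complex :: "'v set set \<Rightarrow> bool" where
  "simplicial_complex K \<longleftrightarrow>
     (\<forall>\<sigma>\<in>K. finite \<sigma> \<and> \<sigma> \<noteq> {}) \<and>
     (\<forall>\<sigma>\<in>K. \<forall>\<tau>. \<tau> \<subseteq> \<sigma> \<and> \<tau> \<noteq> {} \<longrightarrow> \<tau> \<in> K)"

definition subcomplex :: "'v set set \<Rightarrow> 'v set set \<Rightarrow> bool" where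
  "subcomplex A K \<longleftrightarrow> simplicial_complex A \<and> A \<subseteq> K"

definition has_dimension :: "'v set set \<Rightarrow> nat \<Rightarrow> bool" where
  "has_dimension P m \<longleftrightarrow> (\<forall>\<sigma>\<in>P. card \<sigma> \<le> Suc m) \<and> (\<exists>\<sigma>\<in>P. card \<sigma> = Suc m)"

definition edge_path_connected :: "'v set set \<Rightarrow> bool" where
  "edge_path_connected K \<longleftrightarrow> (\<forall>u\<in>\<Union>K. \<forall>v\<in>\<Union>K. (\<lambda>x y. {x, y} \<in> K)\<^sup>*\<^sup>* u v)"

definition simplicial_map :: "'v set set \<Rightarrow> 'w set set \<Rightarrow> ('v \<Rightarrow> 'w) \<Rightarrow> bool" where
  "simplicial_map A B f \<longleftrightarrow> (\<forall>\<sigma>\<in>A. f ` \<sigma> \<in> B)"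

definition contiguous :: "'v set set \<Rightarrow> 'w set set \<Rightarrow> ('v \<Rightarrow> 'w) \<Rightarrow> ('v \<Rightarrow> 'w) \<Rightarrow> bool" where
  "contiguous A B f g \<longleftrightarrow> (\<forall>\<sigma>\<in>A. f ` \<sigma> \<union> g ` \<sigma> \<in> B)"

definition same_contiguity_class ::
  "'v set set \<Rightarrow> 'w set set \<Rightarrow> ('v \<Rightarrow> 'w) \<Rightarrow> ('v \<Rightarrow> 'w) \<Rightarrow> bool" where
  "same_contiguity_class A B f g \<longleftrightarrow>
     (\<exists>n F. F 0 = f \<and> F n = g \<and>
        (\<forall>i\<le>n. simplicial_map A B (F i)) \<and>
        (\<forall>i<n. contiguous A B (F i) (F (Suc i))))"

definition right_strong_homotopy_inverse ::
  "'v set set \<Rightarrow> 'w set set \<Rightarrow> ('v \<Rightarrow> 'w) \<Rightarrow> ('w \<Rightarrow> 'v) \<Rightarrow> bool" where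
  "right_strong_homotopy_inverse K' K \<beta> b \<longleftrightarrow>
     simplicial_map K K' b \<and> same_contiguity_class K K (\<beta> \<circ> b) id"

definition left_strong_homotopy_inverse ::
  "'v set set \<Rightarrow> 'w set set \<Rightarrow> ('v \<Rightarrow> 'w) \<Rightarrow> ('w \<Rightarrow> 'v) \<Rightarrow> bool" where
  "left_strong_homotopy_inverse L L' \<alpha> a \<longleftrightarrow>
     simplicial_map L' L a \<and> same_contiguity_class L L (a \<circ> \<alpha>) id"

text \<open>The mathematical condition quantifies over \<open>m\<close>-dimensional complexes \<open>P\<close> on arbitrary vertex
  sets.  A definition cannot quantify over types, so the vertices of \<open>P\<close> are taken from
  \<open>'v + nat\<close>; the lemma \<open>m_contiguous_on_any_vertex_type\<close> below shows that this implies the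
  condition for \<open>P\<close> over every vertex type.\<close>

definition m_contiguous_on ::
  "nat \<Rightarrow> 'v set set \<Rightarrow> 'w set set \<Rightarrow> ('v \<Rightarrow> 'w) \<Rightarrow> ('v \<Rightarrow> 'w) \<Rightarrow> bool" where
  "m_contiguous_on m A L \<phi> \<psi> \<longleftrightarrow>
     (\<forall>(P :: ('v + nat) set set) \<eta>.
        simplicial_complex P \<and> has_dimension P m \<and> simplicial_map P A \<eta> \<longrightarrow>
        same_contiguity_class P L (\<phi> \<circ> \<eta>) (\<psi> \<circ> \<eta>))"

definition SD ::
  "nat \<Rightarrow> 'v set set \<Rightarrow> 'w set set \<Rightarrow> ('v \<Rightarrow> 'w) \<Rightarrow> ('v \<Rightarrow> 'w) \<Rightarrow> enat" where
  "SD m K L \<phi> \<psi> =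
     Inf {enat k | k. \<exists>C. (\<forall>j\<le>k. subcomplex (C j) K) \<and> (\<Union>j\<le>k. C j) = K \<and>
                          (\<forall>j\<le>k. m_contiguous_on m (C j) L \<phi> \<psi>)}"

lemma same_contiguity_class_precomp:
  assumes "same_contiguity_class Q L f g" and h: "simplicial_map P Q h"
  shows "same_contiguity_class P L (f \<circ> h) (g \<circ> h)"
proof -
  obtain n F where F: "F 0 = f" "F n = g" "\<forall>i\<le>n. simplicial_map Q L (F i)"
    "\<forall>i<n. contiguous Q L (F i) (F (Suc i))"
    using assms(1) unfolding same_contiguity_class_def by blast
  have "\<forall>i\<le>n. simplicial_map P L (F i \<circ> h)"
    using F(3) h unfolding simplicial_map_def image_comp[symmetric] by blast
  moreover have "\<forall>i<n. contiguous P L (F i \<circ> h) (F (Suc i) \<circ> h)"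
    using F(4) h unfolding simplicial_map_def contiguous_def image_comp[symmetric] by blast
  ultimately show ?thesis
    unfolding same_contiguity_class_def using F(1,2)
    by (intro exI[of _ n] exI[of _ "\<lambda>i. F i \<circ> h"]) auto
qed

lemma m_contiguous_on_any_vertex_type:
  fixes A :: "'v set set" and P :: "'p set set"
  assumes A: "simplicial_complex A" and m: "m_contiguous_on m A L \<phi> \<psi>"
    and P: "simplicial_complex P" "has_dimension P m" and \<eta>: "simplicial_map P A \<eta>"
  shows "same_contiguity_class P L (\<phi> \<circ> \<eta>) (\<psi> \<circ> \<eta>)"
proof -
  obtain \<sigma>0 where \<sigma>0: "\<sigma>0 \<in> P" using P(2) unfolding has_dimension_def by blast
  then have s: "\<eta> ` \<sigma>0 \<in> A" using \<eta> unfolding simplicial_map_def by blast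
  have Af: "finite \<sigma>" "\<sigma> \<noteq> {}" if "\<sigma> \<in> A" for \<sigma>
    using A that unfolding simplicial_complex_def by auto
  have As: "\<tau> \<in> A" if "\<sigma> \<in> A" "\<tau> \<subseteq> \<sigma>" "\<tau> \<noteq> {}" for \<sigma> \<tau>
    using A that unfolding simplicial_complex_def by metis
  obtain v where v: "v \<in> \<eta> ` \<sigma>0" using Af(2)[OF s] by blast
  have vA: "{v} \<in> A" by (rule As[OF s]) (use v in auto)
  define Q1 :: "('v + nat) set set" where "Q1 = (`) Inl ` {\<sigma> \<in> A. card \<sigma> \<le> Suc m}"
  define Q2 :: "('v + nat) set set" where "Q2 = {\<tau>. \<tau> \<subseteq> Inr ` {..m} \<and> \<tau> \<noteq> {}}"
  define \<theta> :: "'v + nat \<Rightarrow> 'v" where "\<theta> = case_sum (\<lambda>x. x) (\<lambda>_. v)"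
  have fin: "finite (Inr ` {..m} :: ('v + nat) set)" by simp
  have cardI: "card (Inr ` {..m} :: ('v + nat) set) = Suc m" by (simp add: card_image)
  have Q2f: "finite \<tau> \<and> \<tau> \<noteq> {} \<and> card \<tau> \<le> Suc m" if "\<tau> \<in> Q2" for \<tau>
  proof -
    have t: "\<tau> \<subseteq> Inr ` {..m}" "\<tau> \<noteq> {}" using that unfolding Q2_def by auto
    show ?thesis using finite_subset[OF t(1) fin] card_mono[OF fin t(1)] t(2) cardI by simp
  qed
  have Q1f: "finite \<tau> \<and> \<tau> \<noteq> {} \<and> card \<tau> \<le> Suc m" if "\<tau> \<in> Q1" for \<tau>
    using that Af unfolding Q1_def by (auto simp: card_image)
  have Q1s: "\<rho> \<in> Q1" if t: "\<tau> \<in> Q1" and r: "\<rho> \<subseteq> \<tau>" "\<rho> \<noteq> {}" for \<tau> \<rho>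
  proof -
    obtain \<sigma> where \<sigma>: "\<sigma> \<in> A" "card \<sigma> \<le> Suc m" "\<tau> = Inl ` \<sigma>" using t unfolding Q1_def by blast
    then obtain \<sigma>' where \<sigma>': "\<sigma>' \<subseteq> \<sigma>" "\<rho> = Inl ` \<sigma>'" using r by (meson subset_imageE)
    have "finite \<sigma>" using Af(1)[OF \<sigma>(1)] .
    then have "card \<sigma>' \<le> Suc m" using \<sigma>'(1) \<sigma>(2) card_mono le_trans by blast
    moreover have "\<sigma>' \<in> A" by (rule As[OF \<sigma>(1) \<sigma>'(1)]) (use \<sigma>'(2) r(2) in auto)
    ultimately show ?thesis using \<sigma>'(2) unfolding Q1_def by blast
  qed
  have Q2s: "\<rho> \<in> Q2" if "\<tau> \<in> Q2" "\<rho> \<subseteq> \<tau>" "\<rho> \<noteq> {}" for \<tau> \<rho>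
    using that unfolding Q2_def by blast
  have "simplicial_complex (Q1 \<union> Q2)"
    unfolding simplicial_complex_def using Q1f Q2f Q1s Q2s by (metis Un_iff)
  moreover have "Inr ` {..m} \<in> Q2" unfolding Q2_def by blast
  then have "has_dimension (Q1 \<union> Q2) m"
    unfolding has_dimension_def using Q1f Q2f cardI by (metis Un_iff)
  moreover have "\<theta> ` \<tau> \<in> A" if "\<tau> \<in> Q1" for \<tau>
    using that unfolding Q1_def \<theta>_def by (auto simp: image_image)
  moreover have "\<theta> ` \<tau> \<in> A" if "\<tau> \<in> Q2" for \<tau>
  proof -
    have "\<theta> ` \<tau> = {v}" using that unfolding Q2_def \<theta>_def by force
    then show ?thesis using vA by simp
  qed
  ultimately have "same_contiguity_class (Q1 \<union> Q2) L (\<phi> \<circ> \<theta>) (\<psi> \<circ> \<theta>)"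
    using m unfolding m_contiguous_on_def simplicial_map_def by (metis (no_types, lifting) Un_iff)
  moreover have "simplicial_map P (Q1 \<union> Q2) (Inl \<circ> \<eta>)"
    unfolding simplicial_map_def
  proof
    fix \<sigma> assume \<sigma>: "\<sigma> \<in> P"
    have "finite \<sigma>" using \<sigma> P(1) unfolding simplicial_complex_def by metis
    moreover have "card \<sigma> \<le> Suc m" using \<sigma> P(2) unfolding has_dimension_def by metis
    ultimately have "card (\<eta> ` \<sigma>) \<le> Suc m" using card_image_le[of \<sigma> \<eta>] by linarith
    moreover have "\<eta> ` \<sigma> \<in> A" using \<sigma> \<eta> unfolding simplicial_map_def by simp
    ultimately have "Inl ` (\<eta> ` \<sigma>) \<in> Q1" unfolding Q1_def by simp
    then show "(Inl \<circ> \<eta>) ` \<sigma> \<in> Q1 \<union> Q2"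
      by (simp add: image_comp)
  qed
  ultimately have "same_contiguity_class P L ((\<phi> \<circ> \<theta>) \<circ> (Inl \<circ> \<eta>)) ((\<psi> \<circ> \<theta>) \<circ> (Inl \<circ> \<eta>))"
    by (rule same_contiguity_class_precomp)
  moreover have "(\<phi> \<circ> \<theta>) \<circ> (Inl \<circ> \<eta>) = \<phi> \<circ> \<eta>" "(\<psi> \<circ> \<theta>) \<circ> (Inl \<circ> \<eta>) = \<psi> \<circ> \<eta>"
    by (auto simp: \<theta>_def)
  ultimately show ?thesis by simp
qed

end

theory Submission
  imports Defs
begin

text \<open>\<open>SD\<close> cannot increase under \<open>\<phi> \<mapsto> \<alpha> \<circ> \<phi> \<circ> \<beta>\<close>, because the \<open>\<beta>\<close>-preimages of a cover form a cover, and
  it depends only on contiguity classes.  The homotopy inverses turn \<open>\<phi>'\<close> back into \<open>\<phi>\<close>, since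
  \<open>a \<circ> \<phi>' \<circ> b \<sim> (a \<circ> \<alpha>) \<circ> \<phi> \<circ> (\<beta> \<circ> b) \<sim> \<phi>\<close>, so the inequality also holds the other way.\<close>

lemma same_contiguity_class_sym:
  assumes "same_contiguity_class A B f g"
  shows "same_contiguity_class A B g f"
proof -
  obtain n F where F: "F 0 = f" "F n = g" "\<forall>i\<le>n. simplicial_map A B (F i)"
    "\<forall>i<n. contiguous A B (F i) (F (Suc i))"
    using assms unfolding same_contiguity_class_def by blast
  have "contiguous A B (F (n - i)) (F (n - Suc i))" if "i < n" for i
  proof -
    \<comment> \<open>Step \<open>i\<close> of the reversed chain is step \<open>n - Suc i\<close>
      of the given one read backwards; contiguity is symmetric because it only involves a union of
      images.\<close>
    have "contiguous A B (F (n - Suc i)) (F (Suc (n - Suc i)))"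
      using F(4) that by simp
    then show ?thesis
      using that by (simp add: Suc_diff_Suc contiguous_def Un_commute)
  qed
  then show ?thesis
    unfolding same_contiguity_class_def using F
    by (intro exI[of _ n] exI[of _ "\<lambda>i. F (n - i)"]) auto
qed

lemma same_contiguity_class_trans:
  assumes "same_contiguity_class A B f g" and "same_contiguity_class A B g h"
  shows "same_contiguity_class A B f h"
proof -
  obtain n F where F: "F 0 = f" "F n = g" "\<forall>i\<le>n. simplicial_map A B (F i)"
    "\<forall>i<n. contiguous A B (F i) (F (Suc i))"
    using assms(1) unfolding same_contiguity_class_def by blast
  obtain k G where G: "G 0 = g" "G k = h" "\<forall>i\<le>k. simplicial_map A B (G i)"
    "\<forall>i<k. contiguous A B (G i) (G (Suc i))"
    using assms(2) unfolding same_contiguity_class_def by blast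
  define H where "H = (\<lambda>i. if i \<le> n then F i else G (i - n))"
  \<comment> \<open>Both chains pass through \<open>g\<close> at index \<open>n\<close>, so the
    second branch is valid already from \<open>n\<close> on. The step from \<open>n\<close> to
    \<open>Suc n\<close> is then a step of \<open>G\<close> alone.\<close>
  have H_after: "H i = G (i - n)" if "n \<le> i" for i
    using that F(2) G(1) by (cases "i = n") (auto simp: H_def)
  have "H 0 = f" "H (n + k) = h"
    using F(1) G(2) H_after[of "n + k"] by (auto simp: H_def)
  moreover have "simplicial_map A B (H i)" if "i \<le> n + k" for i
    using that F(3) G(3) by (auto simp: H_def)
  moreover have "contiguous A B (H i) (H (Suc i))" if "i < n + k" for i
  proof (cases "i < n")
    case True
    then show ?thesis using F(4) by (simp add: H_def)
  next
    case False
    then show ?thesis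
      using that G(4) H_after[of i] H_after[of "Suc i"] by (simp add: Suc_diff_le)
  qed
  ultimately show ?thesis
    unfolding same_contiguity_class_def by blast
qed

lemma same_contiguity_class_postcomp:
  assumes "same_contiguity_class A B f g" and h: "simplicial_map B C h"
  shows "same_contiguity_class A C (h \<circ> f) (h \<circ> g)"
proof -
  obtain n F where F: "F 0 = f" "F n = g" "\<forall>i\<le>n. simplicial_map A B (F i)"
    "\<forall>i<n. contiguous A B (F i) (F (Suc i))"
    using assms(1) unfolding same_contiguity_class_def by blast
  have "\<forall>i\<le>n. simplicial_map A C (h \<circ> F i)"
    using F(3) h unfolding simplicial_map_def image_comp[symmetric] by blast
  moreover have "\<forall>i<n. contiguous A C (h \<circ> F i) (h \<circ> F (Suc i))"
    using F(4) h unfolding simplicial_map_def contiguous_def image_comp[symmetric] image_Un[symmetric]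
    by blast
  ultimately show ?thesis
    unfolding same_contiguity_class_def using F(1,2)
    by (intro exI[of _ n] exI[of _ "\<lambda>i. h \<circ> F i"]) auto
qed

text \<open>A test map \<eta> into \<open>A'\<close> becomes a test map \<beta> \<circ> \<eta> into
  \<open>A\<close>, and \<alpha> carries the resulting chain to \<open>L'\<close>. The vertices of
  \<open>P\<close> lie in \<open>'c + nat\<close>, whereas the hypothesis on \<open>A\<close> tests
  only complexes on its own vertex type plus \<open>nat\<close>;
  \<open>m_contiguous_on_any_vertex_type\<close> bridges this gap.\<close>

lemma m_contiguous_on_transfer:
  assumes A: "simplicial_complex A" and m: "m_contiguous_on m A L \<phi> \<psi>"
    and \<beta>: "simplicial_map A' A \<beta>" and \<alpha>: "simplicial_map L L' \<alpha>"
    and \<phi>': "same_contiguity_class A' L' (\<alpha> \<circ> \<phi> \<circ> \<beta>) \<phi>'"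
    and \<psi>': "same_contiguity_class A' L' (\<alpha> \<circ> \<psi> \<circ> \<beta>) \<psi>'"
  shows "m_contiguous_on m A' L' \<phi>' \<psi>'"
  unfolding m_contiguous_on_def
proof (intro allI impI, elim conjE)
  fix P :: "('c + nat) set set" and \<eta>
  assume P: "simplicial_complex P" "has_dimension P m" and \<eta>: "simplicial_map P A' \<eta>"
  have "simplicial_map P A (\<beta> \<circ> \<eta>)"
    using \<eta> \<beta> unfolding simplicial_map_def image_comp[symmetric] by blast
  from m_contiguous_on_any_vertex_type[OF A m P this]
  have "same_contiguity_class P L' ((\<alpha> \<circ> \<phi> \<circ> \<beta>) \<circ> \<eta>) ((\<alpha> \<circ> \<psi> \<circ> \<beta>) \<circ> \<eta>)"
    using same_contiguity_class_postcomp[OF _ \<alpha>] by (simp only: comp_assoc)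
  \<comment> \<open>The chain obtained is extended at both ends by the given classes of \<phi>' and
    \<psi>', precomposed with \<eta>.\<close>
  then show "same_contiguity_class P L' (\<phi>' \<circ> \<eta>) (\<psi>' \<circ> \<eta>)"
    using same_contiguity_class_precomp[OF \<phi>' \<eta>] same_contiguity_class_precomp[OF \<psi>' \<eta>]
    by (meson same_contiguity_class_sym same_contiguity_class_trans)
qed

text \<open>Restriction is precomposition with the inclusion, which is \<open>id\<close> in this
  encoding of maps.\<close>

lemma same_contiguity_class_subset:
  assumes "same_contiguity_class A B f g" and "A' \<subseteq> A"
  shows "same_contiguity_class A' B f g"
proof -
  have "simplicial_map A' A id"
    using assms(2) by (auto simp: simplicial_map_def)
  from same_contiguity_class_precomp[OF assms(1) this] show ?thesis by simp
qed

lemma subcomplex_preimage: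
  assumes K': "simplicial_complex K'" and A: "simplicial_complex A"
  shows "subcomplex {\<sigma> \<in> K'. f ` \<sigma> \<in> A} K'"
proof -
  have "finite \<sigma> \<and> \<sigma> \<noteq> {}" if "\<sigma> \<in> K'" for \<sigma>
    using K' that unfolding simplicial_complex_def by auto
  moreover have "\<tau> \<in> K'" if "\<sigma> \<in> K'" "\<tau> \<subseteq> \<sigma>" "\<tau> \<noteq> {}" for \<sigma> \<tau>
    using K' that unfolding simplicial_complex_def by metis
  moreover have "f ` \<tau> \<in> A" if "f ` \<sigma> \<in> A" "\<tau> \<subseteq> \<sigma>" "\<tau> \<noteq> {}" for \<sigma> \<tau>
    using A that unfolding simplicial_complex_def by (metis image_is_empty image_mono)
  ultimately show ?thesis
    unfolding subcomplex_def simplicial_complex_def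
    by (metis (mono_tags, lifting) mem_Collect_eq subsetI)
qed

lemma SD_transfer_le:
  assumes K': "simplicial_complex K'"
    and \<beta>: "simplicial_map K' K \<beta>" and \<alpha>: "simplicial_map L L' \<alpha>"
    and \<phi>': "same_contiguity_class K' L' (\<alpha> \<circ> \<phi> \<circ> \<beta>) \<phi>'"
    and \<psi>': "same_contiguity_class K' L' (\<alpha> \<circ> \<psi> \<circ> \<beta>) \<psi>'"
  shows "SD m K' L' \<phi>' \<psi>' \<le> SD m K L \<phi> \<psi>"
proof -
  have "\<exists>C'. (\<forall>j\<le>k. subcomplex (C' j) K') \<and> (\<Union>j\<le>k. C' j) = K' \<and>
      (\<forall>j\<le>k. m_contiguous_on m (C' j) L' \<phi>' \<psi>')"
    if C: "\<forall>j\<le>k. subcomplex (C j) K" "(\<Union>j\<le>k. C j) = K"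
      "\<forall>j\<le>k. m_contiguous_on m (C j) L \<phi> \<psi>" for k :: nat and C
  proof -
    define C' where "C' = (\<lambda>j. {\<sigma> \<in> K'. \<beta> ` \<sigma> \<in> C j})"
    have "subcomplex (C' j) K'" if "j \<le> k" for j
      unfolding C'_def using subcomplex_preimage[OF K'] C(1) that
      unfolding subcomplex_def by blast
    \<comment> \<open>The image of a simplex of \<open>K'\<close> is a simplex of \<open>K\<close>,
      hence lies in some \<open>C j\<close>.\<close>
    moreover have "(\<Union>j\<le>k. C' j) = K'"
      using \<beta> C(2) unfolding C'_def simplicial_map_def by blast
    moreover have "m_contiguous_on m (C' j) L' \<phi>' \<psi>'" if "j \<le> k" for j
    proof (rule m_contiguous_on_transfer[OF _ _ _ \<alpha>])
      show "simplicial_complex (C j)" "m_contiguous_on m (C j) L \<phi> \<psi>"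
        using C that unfolding subcomplex_def by auto
      show "simplicial_map (C' j) (C j) \<beta>"
        by (simp add: C'_def simplicial_map_def)
      show "same_contiguity_class (C' j) L' (\<alpha> \<circ> \<phi> \<circ> \<beta>) \<phi>'"
        "same_contiguity_class (C' j) L' (\<alpha> \<circ> \<psi> \<circ> \<beta>) \<psi>'"
        using \<phi>' \<psi>' by (auto simp: C'_def elim: same_contiguity_class_subset)
    qed
    ultimately show ?thesis by blast
  qed
  \<comment> \<open>Each \<open>k\<close> admissible for \<open>K\<close> is thus admissible for
    \<open>K'\<close>, and the infimum over the larger set is smaller. If \<open>K\<close> has no
    cover of this kind, the right-hand side is \<open>Inf {}\<close>, that is, infinity.\<close>
  then show ?thesis
    unfolding SD_def by (intro Inf_superset_mono) blast
qed

text \<open>This is the class hypothesis of \<open>SD_transfer_le\<close> with \<open>b\<close> and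
  \<open>a\<close> in the roles of \<beta> and \<alpha>, and with primed and unprimed data
  exchanged.\<close>

lemma same_contiguity_class_recover:
  assumes b: "right_strong_homotopy_inverse K' K \<beta> b"
    and a: "left_strong_homotopy_inverse L L' \<alpha> a"
    and \<phi>: "simplicial_map K L \<phi>"
    and \<phi>': "same_contiguity_class K' L' (\<alpha> \<circ> \<phi> \<circ> \<beta>) \<phi>'"
  shows "same_contiguity_class K L (a \<circ> \<phi>' \<circ> b) \<phi>"
proof -
  have b': "simplicial_map K K' b" "same_contiguity_class K K (\<beta> \<circ> b) id"
    and a': "simplicial_map L' L a" "same_contiguity_class L L (a \<circ> \<alpha>) id"
    using b a by (simp_all add: right_strong_homotopy_inverse_def left_strong_homotopy_inverse_def)
  have \<phi>\<beta>b: "same_contiguity_class K L (\<phi> \<circ> (\<beta> \<circ> b)) \<phi>"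
    using same_contiguity_class_postcomp[OF b'(2) \<phi>] by simp
  \<comment> \<open>All maps in a chain are simplicial, so the chain just found yields this for its
    first member.\<close>
  then have "simplicial_map K L (\<phi> \<circ> (\<beta> \<circ> b))"
    unfolding same_contiguity_class_def by (metis le0)
  from same_contiguity_class_precomp[OF a'(2) this]
  have "same_contiguity_class K L (a \<circ> (\<alpha> \<circ> \<phi> \<circ> \<beta>) \<circ> b) (\<phi> \<circ> (\<beta> \<circ> b))"
    by (simp add: comp_assoc)
  \<comment> \<open>The same left-hand map is now joined to
    \<open>a \<circ> \<phi>' \<circ> b\<close>, by composing the chain for \<phi>' with
    \<open>a\<close> and \<open>b\<close>.\<close>
  moreover have "same_contiguity_class K L (a \<circ> (\<alpha> \<circ> \<phi> \<circ> \<beta>) \<circ> b) (a \<circ> \<phi>' \<circ> b)"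
    using \<phi>' a'(1) b'(1) by (intro same_contiguity_class_precomp same_contiguity_class_postcomp)
  ultimately show ?thesis
    using \<phi>\<beta>b by (meson same_contiguity_class_sym same_contiguity_class_trans)
qed

theorem theorem3p1:
  fixes m :: nat
    and K :: "'a set set" and L :: "'b set set"
    and K' :: "'c set set" and L' :: "'d set set"
    and \<phi> \<psi> :: "'a \<Rightarrow> 'b" and \<phi>' \<psi>' :: "'c \<Rightarrow> 'd"
    and \<alpha> :: "'b \<Rightarrow> 'd" and \<beta> :: "'c \<Rightarrow> 'a"
  assumes "simplicial_complex K" "simplicial_complex L"
    and "simplicial_complex K'" "simplicial_complex L'"
    and "edge_path_connected K" "edge_path_connected L"
    and "edge_path_connected K'" "edge_path_connected L'"
    and "simplicial_map K' K \<beta>"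
    and "\<exists>b. right_strong_homotopy_inverse K' K \<beta> b"
    and "simplicial_map L L' \<alpha>"
    and "\<exists>a. left_strong_homotopy_inverse L L' \<alpha> a"
    and "simplicial_map K L \<phi>" "simplicial_map K L \<psi>"
    and "simplicial_map K' L' \<phi>'" "simplicial_map K' L' \<psi>'"
    and "same_contiguity_class K' L' (\<alpha> \<circ> \<phi> \<circ> \<beta>) \<phi>'"
    and "same_contiguity_class K' L' (\<alpha> \<circ> \<psi> \<circ> \<beta>) \<psi>'"
  shows "SD m K L \<phi> \<psi> = SD m K' L' \<phi>' \<psi>'"
proof (rule antisym)
  obtain b where b: "right_strong_homotopy_inverse K' K \<beta> b"
    using assms(10) by blast
  obtain a where a: "left_strong_homotopy_inverse L L' \<alpha> a"
    using assms(12) by blast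
  have "simplicial_map K K' b" "simplicial_map L' L a"
    using b a by (simp_all add: right_strong_homotopy_inverse_def left_strong_homotopy_inverse_def)
  \<comment> \<open>Here covers of \<open>K'\<close> are pulled back to \<open>K\<close> along
    \<open>b\<close>.\<close>
  then show "SD m K L \<phi> \<psi> \<le> SD m K' L' \<phi>' \<psi>'"
    using same_contiguity_class_recover[OF b a] assms(1,13,14,17,18)
    by (intro SD_transfer_le) auto
  show "SD m K' L' \<phi>' \<psi>' \<le> SD m K L \<phi> \<psi>"
    using assms(3,9,11,17,18) by (rule SD_transfer_le)
qed

end
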